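(* For any sequence $l=\{a_i;\ i=1,2,3,\dots\}$ of real numbers and any real number $r\ge0$, the set $L_{r\text{-}\mathrm{stat}}(l)=\{a\in\mathbb{R}: a=\mathrm{stat}\text{-}r\text{-}\lim l\}$ is a convex subset of the real numbers.
   Context: $\mathbb{N}=\{1,2,3,\dots\}$. For $K\subseteq\mathbb{N}$ put $K_n=\{k\in K: k\le n\}$; the asymptotic density of $K$ is $d(K)=\lim_{n\to\infty}\frac1n|K_n|$ whenever the limit exists. For a real $r\ge0$, $a=\mathrm{stat}\text{-}r\text{-}\lim l$ ($a$ is a statistical $r$-limit of $l$) means that for every $\varepsilon>0$ the set $\{i\in\mathbb{N}: |a_i-a|\ge r+\varepsilon\}$ has density $0$. *)

theory Defs
  imports "HOL-Analysis.Analysis"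
begin

text \<open>
  The natural numbers of the source start at 1. A sequence \<open>a\<^sub>1, a\<^sub>2, \<dots>\<close> is a function on
  \<^typ>\<open>nat\<close> whose value at 0 is irrelevant, and the index 0 never counts towards a density.
\<close>

definition initial_part :: "nat set \<Rightarrow> nat \<Rightarrow> nat set" where
  "initial_part K n = {k \<in> K. 1 \<le> k \<and> k \<le> n}"

text \<open>Stated as a relation, so that a density of 0 includes the existence of the limit.\<close>

definition has_asymptotic_density :: "nat set \<Rightarrow> real \<Rightarrow> bool" where
  "has_asymptotic_density K d \<longleftrightarrow> (\<lambda>n. 1 / real n * real (card (initial_part K n))) \<longlonglongrightarrow> d"

definition is_stat_limit :: "real \<Rightarrow> (nat \<Rightarrow> real) \<Rightarrow> real \<Rightarrow> bool" where
  "is_stat_limit r l a \<longleftrightarrow>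
     (\<forall>\<epsilon>>0. has_asymptotic_density {i. 1 \<le> i \<and> \<bar>l i - a\<bar> \<ge> r + \<epsilon>} 0)"

definition stat_limits :: "real \<Rightarrow> (nat \<Rightarrow> real) \<Rightarrow> real set" where
  "stat_limits r l = {a. is_stat_limit r l a}"

end

theory Submission
  imports Defs
begin

text \<open>
  The number \<open>a\<close> is a statistical \<open>r\<close>-limit when, for every \<open>\<epsilon> > 0\<close>, almost all terms lie in the
  open ball of radius \<open>r + \<epsilon>\<close> around \<open>a\<close>. Distance to a fixed point is a convex function, so a
  term that is near both \<open>a\<close> and \<open>b\<close> is equally near every convex combination \<open>c\<close> of them. The
  exceptional indices of \<open>c\<close> are therefore among those of \<open>a\<close> and those of \<open>b\<close>, and the sets of
  density zero are closed under finite unions and subsets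
  (\<open>has_asymptotic_density_zero_subset_Un\<close>).
\<close>

lemma finite_initial_part: "finite (initial_part K n)"
  by (rule finite_subset[of _ "{..n}"]) (auto simp: initial_part_def)

lemma has_asymptotic_density_zero_subset_Un:
  assumes A: "has_asymptotic_density A 0" and B: "has_asymptotic_density B 0"
    and sub: "K \<subseteq> A \<union> B"
  shows "has_asymptotic_density K 0"
proof -
  let ?f = "\<lambda>K n. 1 / real n * real (card (initial_part K n))"
  have le: "?f K n \<le> ?f A n + ?f B n" for n
  proof -
    have "initial_part K n \<subseteq> initial_part A n \<union> initial_part B n"
      using sub by (auto simp: initial_part_def)
    then have "card (initial_part K n) \<le> card (initial_part A n \<union> initial_part B n)"
      by (intro card_mono) (simp_all add: finite_initial_part)
    also have "\<dots> \<le> card (initial_part A n) + card (initial_part B n)"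
      by (rule card_Un_le)
    finally have "1 / real n * real (card (initial_part K n))
        \<le> 1 / real n * real (card (initial_part A n) + card (initial_part B n))"
      by (intro mult_left_mono) simp_all
    then show ?thesis
      by (simp add: distrib_left)
  qed
  have "(\<lambda>n. ?f A n + ?f B n) \<longlonglongrightarrow> 0"
    using tendsto_add[OF A[unfolded has_asymptotic_density_def]
        B[unfolded has_asymptotic_density_def]] by simp
  then have "?f K \<longlonglongrightarrow> 0"
    by (rule tendsto_sandwich[OF always_eventually always_eventually tendsto_const, rotated 2])
      (use le in auto)
  then show ?thesis
    unfolding has_asymptotic_density_def .
qed

theorem theorem3p3:
  fixes l :: "nat \<Rightarrow> real" and r :: real
  assumes "r \<ge> 0"
  shows "convex (stat_limits r l)"
proof (rule convexI)
  fix a b u v :: real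
  assume a: "a \<in> stat_limits r l" and b: "b \<in> stat_limits r l"
    and uv: "0 \<le> u" "0 \<le> v" "u + v = 1"
  let ?c = "u *\<^sub>R a + v *\<^sub>R b"
  let ?E = "\<lambda>x \<epsilon>. {i. 1 \<le> i \<and> \<bar>l i - x\<bar> \<ge> r + \<epsilon>}"
  have "has_asymptotic_density (?E ?c \<epsilon>) 0" if "\<epsilon> > 0" for \<epsilon>
  proof (rule has_asymptotic_density_zero_subset_Un)
    show "has_asymptotic_density (?E a \<epsilon>) 0" "has_asymptotic_density (?E b \<epsilon>) 0"
      using a b that by (auto simp: stat_limits_def is_stat_limit_def)
    have "\<bar>l i - ?c\<bar> < r + \<epsilon>" if "\<bar>l i - a\<bar> < r + \<epsilon>" "\<bar>l i - b\<bar> < r + \<epsilon>" for i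
      using convexD[OF convex_ball, of a "l i" "r + \<epsilon>" b u v] that uv
      by (simp add: dist_real_def)
    then show "?E ?c \<epsilon> \<subseteq> ?E a \<epsilon> \<union> ?E b \<epsilon>"
      by (auto simp flip: not_less)
  qed
  then show "?c \<in> stat_limits r l"
    by (simp add: stat_limits_def is_stat_limit_def)
qed

end
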